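(* Let $k$ be a field of characteristic different from $2$. (i) The dimension (as a vector space over $k$) of any vector product algebra over $k$ is either $0$, $1$, $3$ or $7$. (ii) Two vector product algebras $V$ and $W$ over $k$ are isomorphic if and only if their respective bilinear forms are equivalent.
   Context: A vector product algebra over $k$ is a $k$-vector space $V$ (not assumed finite-dimensional) equipped with an anti-symmetric bilinear map $V\times V\to V$, $(u,v)\mapsto uv$ (so $uv=-vu$), and a non-degenerate symmetric bilinear form $\langle\cdot,\cdot\rangle:V\times V\to k$ (non-degenerate: $\langle x,v\rangle=0$ for all $x\in V$ implies $v=0$), such that for all $u,v,w\in V$: (1) $\langle uv,w\rangle=\langle u,vw\rangle$; (2) $\langle uv,uv\rangle=\langle u,u\rangle\langle v,v\rangle-\langle u,v\rangle^2$. A morphism of vector product algebras $V\to W$ is an orthogonal map $\varphi:V\to W$ (i.e. a $k$-linear map with $\langle\varphi(u),\varphi(v)\rangle=\langle u,v\rangle$ for all $u,v\in V$) such that $\varphi(uv)=\varphi(u)\varphi(v)$ for all $u,v\in V$. $V$ and $W$ are isomorphic if there exists a bijective morphism $V\to W$. The bilinear forms of $V$ and $W$ are equivalent if there is a $k$-linear bijection $\psi:V\to W$ with $\langle\psi(u),\psi(v)\rangle=\langle u,v\rangle$ for all $u,v\in V$. *)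

theory Defs
  imports "HOL-Computational_Algebra.Computational_Algebra"
begin

text \<open>
  Vector spaces follow the library's \<^locale>\<open>vector_space\<close>: the space is a whole type
  with an explicit scalar multiplication over a type of class \<^class>\<open>field\<close>.
\<close>

context vector_space
begin

text \<open>
  The library's \<^const>\<open>dim\<close> is \<open>0\<close> on an infinite-dimensional space, so
  finiteness of the basis is required explicitly here.
\<close>

definition has_dimension :: "nat \<Rightarrow> bool" where
  "has_dimension n \<longleftrightarrow> (\<exists>B. independent B \<and> span B = UNIV \<and> finite B \<and> card B = n)"

end

locale vector_product_algebra = vector_space scale
  for scale :: "'k::field \<Rightarrow> 'v::ab_group_add \<Rightarrow> 'v" +
  fixes prod :: "'v \<Rightarrow> 'v \<Rightarrow> 'v"  (infixl \<open>\<cdot>\<close> 70)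
    and form :: "'v \<Rightarrow> 'v \<Rightarrow> 'k"
  assumes prod_linear_left: "Vector_Spaces.linear scale scale (\<lambda>u. u \<cdot> v)"
    and prod_linear_right: "Vector_Spaces.linear scale scale (\<lambda>v. u \<cdot> v)"
    and prod_antisym: "u \<cdot> v = - (v \<cdot> u)"
    and form_linear_left: "Vector_Spaces.linear scale (*) (\<lambda>u. form u v)"
    and form_linear_right: "Vector_Spaces.linear scale (*) (\<lambda>v. form u v)"
    and form_sym: "form u v = form v u"
    and form_nondegenerate: "(\<And>x. form x v = 0) \<Longrightarrow> v = 0"
    and form_prod_assoc: "form (u \<cdot> v) w = form u (v \<cdot> w)"
    and form_prod_prod: "form (u \<cdot> v) (u \<cdot> v) = form u u * form v v - (form u v)\<^sup>2"

locale orthogonal_map = Vector_Spaces.linear scaleV scaleW \<phi>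
  for scaleV :: "'k::field \<Rightarrow> 'v::ab_group_add \<Rightarrow> 'v"
    and formV :: "'v \<Rightarrow> 'v \<Rightarrow> 'k"
    and scaleW :: "'k \<Rightarrow> 'w::ab_group_add \<Rightarrow> 'w"
    and formW :: "'w \<Rightarrow> 'w \<Rightarrow> 'k"
    and \<phi> :: "'v \<Rightarrow> 'w" +
  assumes form_preserving: "formW (\<phi> u) (\<phi> v) = formV u v"

locale vpa_morphism =
  V: vector_product_algebra scaleV prodV formV +
  W: vector_product_algebra scaleW prodW formW +
  orthogonal_map scaleV formV scaleW formW \<phi>
  for scaleV :: "'k::field \<Rightarrow> 'v::ab_group_add \<Rightarrow> 'v" and prodV formV
    and scaleW :: "'k \<Rightarrow> 'w::ab_group_add \<Rightarrow> 'w" and prodW formW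
    and \<phi> :: "'v \<Rightarrow> 'w" +
  assumes prod_preserving: "\<phi> (prodV u v) = prodW (\<phi> u) (\<phi> v)"

definition vpa_isomorphic ::
  "('k::field \<Rightarrow> 'v::ab_group_add \<Rightarrow> 'v) \<Rightarrow> ('v \<Rightarrow> 'v \<Rightarrow> 'v) \<Rightarrow> ('v \<Rightarrow> 'v \<Rightarrow> 'k) \<Rightarrow>
   ('k \<Rightarrow> 'w::ab_group_add \<Rightarrow> 'w) \<Rightarrow> ('w \<Rightarrow> 'w \<Rightarrow> 'w) \<Rightarrow> ('w \<Rightarrow> 'w \<Rightarrow> 'k) \<Rightarrow> bool" where
  "vpa_isomorphic scaleV prodV formV scaleW prodW formW \<longleftrightarrow>
     (\<exists>\<phi>. vpa_morphism scaleV prodV formV scaleW prodW formW \<phi> \<and> bij \<phi>)"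

definition forms_equivalent ::
  "('k::field \<Rightarrow> 'v::ab_group_add \<Rightarrow> 'v) \<Rightarrow> ('v \<Rightarrow> 'v \<Rightarrow> 'k) \<Rightarrow>
   ('k \<Rightarrow> 'w::ab_group_add \<Rightarrow> 'w) \<Rightarrow> ('w \<Rightarrow> 'w \<Rightarrow> 'k) \<Rightarrow> bool" where
  "forms_equivalent scaleV formV scaleW formW \<longleftrightarrow>
     (\<exists>\<psi>. orthogonal_map scaleV formV scaleW formW \<psi> \<and> bij \<psi>)"

end

theory Submission
  imports Defs
begin

text \<open>
  Linearising the norm identity gives \<open>u \<cdot> (u \<cdot> w) = \<langle>u, w\<rangle> u - \<langle>u, u\<rangle> w\<close>, which determines the
  product on \<open>S \<oplus> k l \<oplus> S \<cdot> l\<close> from the product on a subalgebra \<open>S\<close> and the norm of a vector \<open>l\<close>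
  orthogonal to \<open>S\<close>. As long as the span of an orthogonal anisotropic basis is proper, there is
  such an \<open>l\<close> of nonzero norm, so one can double starting from \<open>0\<close>; this gives dimensions
  0, 1, 3, 7, and a fourth doubling is impossible because two evaluations of \<open>((i \<cdot> j) \<cdot> l) \<cdot> m\<close>
  differ in sign. For the classification, the isomorphism is extended through each doubling, which
  only requires a vector of the right norm in the orthogonal complement of the image; an isometry
  provides it directly for the first two doublings and up to a reflection for the third.
\<close>

lemma two_neq_0_if_CHAR_neq_2:
  assumes "CHAR('k::field) \<noteq> 2"
  shows "(2::'k) \<noteq> 0"
proof
  assume "(2::'k) = 0"
  then have "of_nat 2 = (0::'k)" by simp
  then have "CHAR('k) dvd 2" by (simp only: of_nat_eq_0_iff_char_dvd)
  moreover have "\<forall>m. m dvd 2 \<longrightarrow> m = 1 \<or> m = (2::nat)"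
    using two_is_prime_nat unfolding prime_nat_iff by blast
  ultimately have "CHAR('k) = 1" using assms by blast
  then show False by simp
qed

section \<open>Linearised identities between the product and the form\<close>

locale vector_product_algebra_char_neq_2 = vector_product_algebra +
  assumes two_neq_0: "(2::'a) \<noteq> 0"
begin

notation scale (infixr \<open>*s\<close> 75)

lemma eq_minus_self_imp_0: "v = - v \<Longrightarrow> v = 0" for v :: 'b
  using two_neq_0
  by (metis add.right_inverse scale_eq_0_iff scale_left_distrib scale_one one_add_one)

lemma prod_distribs [simp]:
  "(u + v) \<cdot> w = u \<cdot> w + v \<cdot> w" "w \<cdot> (u + v) = w \<cdot> u + w \<cdot> v"
  "(c *s u) \<cdot> w = c *s (u \<cdot> w)" "w \<cdot> (c *s u) = c *s (w \<cdot> u)"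
  "(- u) \<cdot> w = - (u \<cdot> w)" "w \<cdot> (- u) = - (w \<cdot> u)"
  "(u - v) \<cdot> w = u \<cdot> w - v \<cdot> w" "w \<cdot> (u - v) = w \<cdot> u - w \<cdot> v"
  "0 \<cdot> w = 0" "w \<cdot> 0 = 0"
proof -
  interpret l: Vector_Spaces.linear scale scale "\<lambda>u. u \<cdot> w" by (rule prod_linear_left)
  interpret r: Vector_Spaces.linear scale scale "\<lambda>u. w \<cdot> u" by (rule prod_linear_right)
  show "(u + v) \<cdot> w = u \<cdot> w + v \<cdot> w" "w \<cdot> (u + v) = w \<cdot> u + w \<cdot> v"
    "(c *s u) \<cdot> w = c *s (u \<cdot> w)" "w \<cdot> (c *s u) = c *s (w \<cdot> u)"
    "(- u) \<cdot> w = - (u \<cdot> w)" "w \<cdot> (- u) = - (w \<cdot> u)"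
    "(u - v) \<cdot> w = u \<cdot> w - v \<cdot> w" "w \<cdot> (u - v) = w \<cdot> u - w \<cdot> v"
    "0 \<cdot> w = 0" "w \<cdot> 0 = 0"
    by (simp_all add: l.add r.add l.scale r.scale l.neg r.neg l.diff r.diff)
qed

lemma form_distribs [simp]:
  "form (u + v) w = form u w + form v w" "form w (u + v) = form w u + form w v"
  "form (c *s u) w = c * form u w" "form w (c *s u) = c * form w u"
  "form (- u) w = - form u w" "form w (- u) = - form w u"
  "form (u - v) w = form u w - form v w" "form w (u - v) = form w u - form w v"
  "form 0 w = 0" "form w 0 = 0"
proof -
  interpret l: Vector_Spaces.linear scale "(*)" "\<lambda>u. form u w" by (rule form_linear_left)
  interpret r: Vector_Spaces.linear scale "(*)" "\<lambda>u. form w u" by (rule form_linear_right)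
  show "form (u + v) w = form u w + form v w" "form w (u + v) = form w u + form w v"
  "form (c *s u) w = c * form u w" "form w (c *s u) = c * form w u"
  "form (- u) w = - form u w" "form w (- u) = - form w u"
  "form (u - v) w = form u w - form v w" "form w (u - v) = form w u - form w v"
  "form 0 w = 0" "form w 0 = 0"
    by (simp_all add: l.add r.add l.scale r.scale l.neg r.neg l.diff r.diff)
qed

lemma form_sum_left: "form (sum f A) w = (\<Sum>a\<in>A. form (f a) w)"
  by (induction A rule: infinite_finite_induct) simp_all

lemma eq_if_form_eq: "(\<And>x. form x u = form x v) \<Longrightarrow> u = v"
  using form_nondegenerate[of "u - v"] by simp

lemma prod_self [simp]: "u \<cdot> u = 0"
  using eq_minus_self_imp_0 prod_antisym by blast

lemma form_prod_left_self [simp]: "form (u \<cdot> v) u = 0" "form u (u \<cdot> v) = 0"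
proof -
  show "form u (u \<cdot> v) = 0" using form_prod_assoc[of u u v] by simp
  then show "form (u \<cdot> v) u = 0" by (simp add: form_sym)
qed

lemma form_prod_right_self [simp]: "form (v \<cdot> u) u = 0" "form u (v \<cdot> u) = 0"
  by (simp_all add: prod_antisym[of v u])

text \<open>Polarising the norm axiom in the second factor yields twice this identity; the 2 cancels
  in characteristic different from 2.\<close>

lemma form_prod_prod_left: "form (u \<cdot> v) (u \<cdot> w) = form u u * form v w - form u v * form u w"
proof -
  have "2 * form (u \<cdot> v) (u \<cdot> w) = 2 * (form u u * form v w - form u v * form u w)"
    using form_prod_prod[of u "v + w"] form_prod_prod[of u v] form_prod_prod[of u w]
      form_sym[of v w] form_sym[of "u \<cdot> v" "u \<cdot> w"]
    by (simp add: algebra_simps power2_eq_square)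
  then show ?thesis by (simp only: mult_left_cancel[OF two_neq_0])
qed

text \<open>Pairing with an arbitrary \<open>x\<close> and moving \<open>u\<close> across the form
  gives \<open>- form (u \<cdot> x) (u \<cdot> w)\<close>, which the polarised norm identity
  evaluates; non-degeneracy then identifies the vectors.\<close>

lemma prod_prod_left: "u \<cdot> (u \<cdot> w) = form u w *s u - form u u *s w"
proof (rule eq_if_form_eq)
  fix x
  have "form x (u \<cdot> (u \<cdot> w)) = - form (u \<cdot> x) (u \<cdot> w)"
    by (simp add: form_prod_assoc[symmetric] prod_antisym[of x u])
  then show "form x (u \<cdot> (u \<cdot> w)) = form x (form u w *s u - form u u *s w)"
    by (simp add: form_prod_prod_left form_sym[of x u] mult.commute)
qed

text \<open>Linearises \<open>prod_prod_left\<close> in \<open>u\<close> by replacing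
  \<open>u\<close> with \<open>u + v\<close>.\<close>

lemma prod_prod_swap:
  "u \<cdot> (v \<cdot> w) = - (v \<cdot> (u \<cdot> w)) - (2 * form u v) *s w + form u w *s v + form v w *s u"
proof -
  have "u \<cdot> (v \<cdot> w) + v \<cdot> (u \<cdot> w) =
      (u + v) \<cdot> ((u + v) \<cdot> w) - u \<cdot> (u \<cdot> w) - v \<cdot> (v \<cdot> w)"
    by simp
  also have "\<dots> = form u w *s v + form v w *s u - (form u v + form v u) *s w"
    unfolding prod_prod_left by (simp add: algebra_simps)
  finally have "u \<cdot> (v \<cdot> w) =
      form u w *s v + form v w *s u - (form u v + form v u) *s w - v \<cdot> (u \<cdot> w)"
    by (simp only: eq_diff_eq)
  moreover have "form u v + form v u = 2 * form u v"
    by (simp only: form_sym[of v u] mult_2)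
  moreover have "a + b - c - d = - d - c + a + b" for a b c d :: 'b
    by (simp add: algebra_simps)
  ultimately show ?thesis by simp
qed

lemma prod_prod_swap_orthogonal:
  "form u v = 0 \<Longrightarrow> form u w = 0 \<Longrightarrow> form v w = 0 \<Longrightarrow> u \<cdot> (v \<cdot> w) = - (v \<cdot> (u \<cdot> w))"
  by (subst prod_prod_swap) simp

text \<open>Follows by swapping \<open>u\<close> and \<open>w\<close> in
  \<open>u \<cdot> (w \<cdot> v)\<close> and using antisymmetry. This sign change is what later
  rules out a fourth doubling.\<close>

lemma prod_assoc_orthogonal:
  "form u v = 0 \<Longrightarrow> form u w = 0 \<Longrightarrow> form v w = 0 \<Longrightarrow> (u \<cdot> v) \<cdot> w = - (u \<cdot> (v \<cdot> w))"
  using prod_prod_swap_orthogonal[of u w v] prod_antisym[of "u \<cdot> v" w] prod_antisym[of v w]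
    form_sym[of v w]
  by simp

section \<open>Cayley-Dickson rules for product and form\<close>

text \<open>
  The next four rules are the Cayley-Dickson multiplication on \<open>S \<oplus> k l \<oplus> S \<cdot> l\<close> for a
  subalgebra \<open>S\<close> orthogonal to \<open>l\<close>.
\<close>

lemma prod_prod_new:
  assumes "form x l = 0" "form y l = 0"
  shows "x \<cdot> (y \<cdot> l) = - ((x \<cdot> y) \<cdot> l) - form x y *s l"
proof -
  have "- (x \<cdot> (y \<cdot> l)) = (x \<cdot> y) \<cdot> l + form x y *s l"
    using prod_prod_swap[of x l y] assms prod_antisym[of l y] prod_antisym[of l "x \<cdot> y"] form_sym[of l y]
    by simp
  then show ?thesis
    by (metis minus_add_distrib minus_minus uminus_add_conv_diff add.commute)
qed

lemma prod_new_new: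
  assumes "form x l = 0"
  shows "(x \<cdot> l) \<cdot> l = - (form l l *s x)"
  using prod_prod_left[of l x] assms form_sym[of l x] prod_antisym[of x l] prod_antisym[of "l \<cdot> x" l]
  by simp

lemma prod_new_prod_new:
  assumes "form x l = 0" "form y l = 0" "form (x \<cdot> y) l = 0"
  shows "(x \<cdot> l) \<cdot> (y \<cdot> l) = - (form l l *s (x \<cdot> y))"
proof -
  \<comment> \<open>Invariance of the form rotates this pairing to
    \<open>- form (x \<cdot> y) l\<close>. With it zero, swapping \<open>x \<cdot> l\<close> past
    \<open>y\<close> leaves no correction terms.\<close>
  have "form (x \<cdot> l) y = 0"
    using assms(3) form_prod_assoc[of y x l] form_sym[of y "x \<cdot> l"] prod_antisym[of y x] by simp
  then have "(x \<cdot> l) \<cdot> (y \<cdot> l) = - (y \<cdot> ((x \<cdot> l) \<cdot> l))"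
    using prod_prod_swap[of "x \<cdot> l" y l] assms by simp
  then show ?thesis
    using assms prod_antisym[of y x] by (simp add: prod_new_new)
qed

lemma cayley_dickson_prod:
  assumes "form x l = 0" "form y l = 0" "form x' l = 0" "form y' l = 0"
    and "form (y \<cdot> y') l = 0"
  shows "(x + s *s l + y \<cdot> l) \<cdot> (x' + s' *s l + y' \<cdot> l) =
    (x \<cdot> x' + (form l l * s) *s y' - (form l l * s') *s y - form l l *s (y \<cdot> y'))
    + (form x' y - form x y') *s l
    + (s' *s x - s *s x' - x \<cdot> y' + x' \<cdot> y) \<cdot> l"
proof -
  have "(y \<cdot> l) \<cdot> x' = (x' \<cdot> y) \<cdot> l + form x' y *s l"
    using prod_antisym[of "y \<cdot> l" x'] prod_prod_new[of x' l y] assms by simp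
  moreover have "l \<cdot> x' = - (x' \<cdot> l)" "l \<cdot> (y' \<cdot> l) = form l l *s y'"
    using prod_antisym[of l x'] prod_antisym[of l "y' \<cdot> l"] prod_new_new[of y' l] assms
    by simp_all
  ultimately show ?thesis
    using assms
    by (simp add: prod_prod_new[of x l y'] prod_new_new[of y l] prod_new_prod_new[of y l y']
        algebra_simps)
qed

text \<open>The correction term in \<open>form_prod_prod_left\<close> has the factor
  \<open>form l x\<close>, so orthogonality of one of the two vectors to \<open>l\<close>
  suffices.\<close>

lemma form_new_new:
  assumes "form x l = 0"
  shows "form (x \<cdot> l) (y \<cdot> l) = form l l * form x y"
  using form_prod_prod_left[of l x y] assms form_sym[of l x] prod_antisym[of x l] prod_antisym[of y l]
  by simp

text \<open>The three components are mutually orthogonal: invariance turns the pairings of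
  \<open>x\<close> with \<open>y' \<cdot> l\<close> and of \<open>y \<cdot> l\<close> with
  \<open>x'\<close> into pairings of a product with \<open>l\<close>, which the last two hypotheses
  kill.\<close>

lemma cayley_dickson_form:
  assumes "form x l = 0" "form y l = 0" "form x' l = 0" "form y' l = 0"
    and "form (x \<cdot> y') l = 0" "form (x' \<cdot> y) l = 0"
  shows "form (x + s *s l + y \<cdot> l) (x' + s' *s l + y' \<cdot> l) =
    form x x' + form l l * (s * s' + form y y')"
proof -
  have "form (y \<cdot> l) x' = 0" "form x (y' \<cdot> l) = 0"
    using assms form_prod_assoc[of x y' l] form_prod_assoc[of x' y l] form_sym[of x' "y \<cdot> l"] by simp_all
  moreover have "form l x' = 0" using assms form_sym[of l x'] by simp
  ultimately show ?thesis
    using assms by (simp add: form_new_new algebra_simps)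
qed


section \<open>Frames and orthogonal projection\<close>

text \<open>The span is thus a finite-dimensional subalgebra. Norms are only nonzero, not normalised
  to 1, since the field may lack square roots.\<close>

definition frame :: "'b set \<Rightarrow> bool" where
  "frame B \<longleftrightarrow> finite B \<and> (\<forall>b\<in>B. form b b \<noteq> 0) \<and> (\<forall>b\<in>B. \<forall>b'\<in>B. b \<noteq> b' \<longrightarrow> form b b' = 0) \<and>
    (\<forall>x\<in>span B. \<forall>y\<in>span B. x \<cdot> y \<in> span B)"

text \<open>For a frame this is the orthogonal projection onto its span.\<close>

definition proj :: "'b set \<Rightarrow> 'b \<Rightarrow> 'b" where
  "proj B v = (\<Sum>b\<in>B. (form v b / form b b) *s b)"

text \<open>A vector product algebra behaves like the imaginary part of a composition algebra. With
  the unit left out, \<open>l\<close> itself is an extra basis vector, so doubling sends size n to 2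
  n + 1.\<close>

definition double :: "'b set \<Rightarrow> 'b \<Rightarrow> 'b set" where
  "double B l = insert l (B \<union> (\<lambda>b. b \<cdot> l) ` B)"

lemma frame_empty: "frame {}"
  by (simp add: frame_def)

lemma proj_add: "proj B (u + v) = proj B u + proj B v"
  by (simp add: proj_def add_divide_distrib scale_left_distrib sum.distrib)

lemma proj_scale: "proj B (c *s v) = c *s proj B v"
  by (simp add: proj_def scale_sum_right)

lemma proj_diff: "proj B (u - v) = proj B u - proj B v"
  by (simp add: proj_def diff_divide_distrib scale_left_diff_distrib sum_subtractf)

lemma proj_in_span: "proj B v \<in> span B"
  unfolding proj_def by (intro span_sum span_scale span_base)

lemma form_span_left_eq_0:
  assumes "x \<in> span B" "\<And>b. b \<in> B \<Longrightarrow> form b l = 0"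
  shows "form x l = 0"
  using assms by (induction rule: span_induct_alt) auto

lemma proj_orthogonal: "(\<And>b. b \<in> B \<Longrightarrow> form b l = 0) \<Longrightarrow> proj B l = 0"
  unfolding proj_def by (rule sum.neutral) (simp add: form_sym[of l])

lemma proj_frame_member:
  assumes "frame B" "b \<in> B"
  shows "proj B b = b"
proof -
  have "proj B b = (\<Sum>b'\<in>B. if b' = b then b else 0)"
    unfolding proj_def using assms by (intro sum.cong) (auto simp: frame_def)
  then show ?thesis using assms by (simp add: frame_def)
qed

lemma proj_span:
  assumes "frame B" "x \<in> span B"
  shows "proj B x = x"
  using assms(2)
proof (induction rule: span_induct_alt)
  case base
  show ?case by (simp add: proj_def)
next
  case (step c x y)
  then show ?case by (simp add: proj_add proj_scale proj_frame_member[OF assms(1)])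
qed

lemma form_proj:
  assumes "frame B" "b \<in> B"
  shows "form (proj B v) b = form v b"
proof -
  have "form (proj B v) b = (\<Sum>b'\<in>B. if b' = b then form v b else 0)"
    unfolding proj_def form_sum_left using assms by (intro sum.cong) (auto simp: frame_def)
  then show ?thesis using assms by (simp add: frame_def)
qed

lemma frame_independent:
  assumes "frame B"
  shows "independent B"
proof (rule independent_if_scalars_zero)
  show "finite B" using assms by (simp add: frame_def)
next
  fix f b assume 0: "(\<Sum>x\<in>B. f x *s x) = 0" and b: "b \<in> B"
  have "form (\<Sum>x\<in>B. f x *s x) b = (\<Sum>x\<in>B. if x = b then f b * form b b else 0)"
    unfolding form_sum_left using assms b by (intro sum.cong) (auto simp: frame_def)
  then show "f b = 0" using 0 assms b by (simp add: frame_def)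
qed

text \<open>A vector outside the span has a nonzero component \<open>perp v\<close> orthogonal to
  \<open>B\<close>. Non-degeneracy supplies \<open>x\<close> with
  \<open>form (perp x) (perp v)\<close> nonzero, and polarisation in characteristic not 2 then
  prevents \<open>perp x\<close>, \<open>perp v\<close> and their sum from all being
  isotropic.\<close>

lemma exists_orthogonal_anisotropic:
  assumes B: "frame B" and "span B \<noteq> UNIV"
  obtains l where "\<And>b. b \<in> B \<Longrightarrow> form b l = 0" "form l l \<noteq> 0"
proof -
  define perp where "perp v = v - proj B v" for v
  have perp: "form b (perp v) = 0" if "b \<in> B" for b v
    using form_proj[OF B that, of v] form_sym[of b] by (simp add: perp_def)
  obtain v where "v \<notin> span B" using assms(2) by blast
  then have "perp v \<noteq> 0"
    using proj_in_span[of B v] unfolding perp_def by auto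
  then obtain x where x: "form x (perp v) \<noteq> 0"
    using form_nondegenerate by blast
  have "form (proj B x) (perp v) = 0"
    using form_span_left_eq_0[OF proj_in_span] perp by blast
  then have "form (perp x) (perp v) \<noteq> 0"
    using x by (simp add: perp_def[of x])
  moreover have "form (perp x + perp v) (perp x + perp v) =
      form (perp x) (perp x) + form (perp v) (perp v) + 2 * form (perp x) (perp v)"
    by (simp add: form_sym[of "perp v" "perp x"])
  ultimately have "form (perp x + perp v) (perp x + perp v) \<noteq> 0 \<or>
      form (perp x) (perp x) \<noteq> 0 \<or> form (perp v) (perp v) \<noteq> 0"
    using two_neq_0 by auto
  moreover have "form b (perp x + perp v) = 0" if "b \<in> B" for b
    using perp that by simp
  ultimately show ?thesis using that perp by blast
qed

section \<open>Doubling a frame\<close>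

lemma subset_double: "B \<subseteq> double B l" "l \<in> double B l"
  by (auto simp: double_def)

lemma prod_in_double: "b \<in> B \<Longrightarrow> b \<cdot> l \<in> double B l"
  by (simp add: double_def)

text \<open>Provides the normal form to which the Cayley-Dickson rules apply.\<close>

lemma span_double:
  "v \<in> span (double B l) \<longleftrightarrow> (\<exists>x\<in>span B. \<exists>y\<in>span B. \<exists>s. v = x + s *s l + y \<cdot> l)"
proof
  assume "v \<in> span (double B l)"
  then show "\<exists>x\<in>span B. \<exists>y\<in>span B. \<exists>s. v = x + s *s l + y \<cdot> l"
  proof (induction rule: span_induct_alt)
    case base
    show ?case by (intro bexI[of _ 0] exI[of _ 0]) (auto simp: span_zero)
  next
    case (step c b v)
    then obtain x y s where xy: "x \<in> span B" "y \<in> span B" and v: "v = x + s *s l + y \<cdot> l"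
      by blast
    from step.hyps consider "b \<in> B" | "b = l" | b' where "b' \<in> B" "b = b' \<cdot> l"
      by (auto simp: double_def)
    then show ?case
    proof cases
      case 1
      then have "c *s b + x \<in> span B" using xy by (simp add: span_add span_scale span_base)
      moreover have "c *s b + v = (c *s b + x) + s *s l + y \<cdot> l"
        using v by (simp add: algebra_simps)
      ultimately show ?thesis using xy by blast
    next
      case 2
      then have "c *s b + v = x + (c + s) *s l + y \<cdot> l"
        using v by (simp add: algebra_simps)
      then show ?thesis using xy by blast
    next
      case 3
      then have "c *s b' + y \<in> span B" using xy by (simp add: span_add span_scale span_base)
      moreover have "c *s b + v = x + s *s l + (c *s b' + y) \<cdot> l"
        using v 3 by (simp add: algebra_simps)
      ultimately show ?thesis using xy by blast
    qed
  qed
next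
  assume "\<exists>x\<in>span B. \<exists>y\<in>span B. \<exists>s. v = x + s *s l + y \<cdot> l"
  then obtain x y s where xy: "x \<in> span B" "y \<in> span B" and v: "v = x + s *s l + y \<cdot> l"
    by blast
  have "y \<cdot> l \<in> span (double B l)"
    using xy(2)
  proof (induction rule: span_induct_alt)
    case base
    show ?case by (simp add: span_zero)
  next
    case (step c b y)
    then show ?case by (simp add: span_add span_scale span_base prod_in_double)
  qed
  moreover have "x \<in> span (double B l)" using xy span_mono[OF subset_double(1)] by blast
  ultimately show "v \<in> span (double B l)"
    unfolding v by (intro span_add span_scale span_base[OF subset_double(2)])
qed

lemma form_frame_span_prod:
  assumes "frame B" "\<And>b. b \<in> B \<Longrightarrow> form b l = 0" "x \<in> span B" "y \<in> span B"
  shows "form (x \<cdot> y) l = 0" "form x (y \<cdot> l) = 0"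
proof -
  have "x \<cdot> y \<in> span B" using assms by (simp add: frame_def)
  then show "form (x \<cdot> y) l = 0" using form_span_left_eq_0 assms by blast
  then show "form x (y \<cdot> l) = 0" by (simp add: form_prod_assoc)
qed

lemma form_double_cases:
  assumes B: "frame B" and l: "\<And>b. b \<in> B \<Longrightarrow> form b l = 0"
    and "b \<in> B" "b' \<in> B"
  shows "form b l = 0" "form l b = 0" "form b (b' \<cdot> l) = 0" "form (b' \<cdot> l) b = 0"
    "form (b \<cdot> l) (b' \<cdot> l) = form l l * form b b'"
proof -
  show bl: "form b l = 0" using assms by blast
  then show "form l b = 0" by (simp add: form_sym)
  show "form b (b' \<cdot> l) = 0"
    using form_frame_span_prod(2)[OF B l] assms by (simp add: span_base)
  then show "form (b' \<cdot> l) b = 0" by (simp add: form_sym)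
  show "form (b \<cdot> l) (b' \<cdot> l) = form l l * form b b'" using bl by (rule form_new_new)
qed

lemma frame_double:
  assumes B: "frame B" and l: "\<And>b. b \<in> B \<Longrightarrow> form b l = 0" and ll: "form l l \<noteq> 0"
  shows "frame (double B l)"
  unfolding frame_def
proof (intro conjI ballI impI)
  show "finite (double B l)" using B by (simp add: double_def frame_def)
  show "form b b \<noteq> 0" if "b \<in> double B l" for b
    using that B ll unfolding double_def frame_def
    by (auto simp: form_double_cases(5)[OF B l])
  show "form b b' = 0" if "b \<in> double B l" "b' \<in> double B l" "b \<noteq> b'" for b b'
  proof -
    have 1: "form a a' = 0" if "a \<in> B" "a' \<in> B" "a \<noteq> a'" for a a'
      using B that by (simp add: frame_def)
    \<comment> \<open>Distinct images under multiplication by \<open>l\<close> come from distinct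
      frame members.\<close>
    then have 2: "form a a' = 0" if "a \<in> B" "a' \<in> B" "a \<cdot> l \<noteq> a' \<cdot> l" for a a'
      using that by blast
    show ?thesis
      using that unfolding double_def by (auto simp: form_double_cases[OF B l] 1 2)
  qed
  show "u \<cdot> v \<in> span (double B l)" if uv: "u \<in> span (double B l)" "v \<in> span (double B l)" for u v
  proof -
    obtain x y s where u: "u = x + s *s l + y \<cdot> l" and xy: "x \<in> span B" "y \<in> span B"
      using uv(1) span_double by blast
    obtain x' y' s' where v: "v = x' + s' *s l + y' \<cdot> l" and xy': "x' \<in> span B" "y' \<in> span B"
      using uv(2) span_double by blast
    have cl: "a \<cdot> b \<in> span B" if "a \<in> span B" "b \<in> span B" for a b
      using B that by (simp add: frame_def)
    have 0: "form a l = 0" if "a \<in> span B" for a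
      using form_span_left_eq_0[OF that l] .
    have eq: "u \<cdot> v =
        (x \<cdot> x' + (form l l * s) *s y' - (form l l * s') *s y - form l l *s (y \<cdot> y'))
        + (form x' y - form x y') *s l
        + (s' *s x - s *s x' - x \<cdot> y' + x' \<cdot> y) \<cdot> l"
      unfolding u v using xy xy' by (intro cayley_dickson_prod 0 cl)
    show ?thesis
      unfolding span_double eq
      \<comment> \<open>Unifying with \<open>refl\<close> takes the witnesses from the three
        components of \<open>eq\<close>; only membership in \<open>span B\<close> remains.\<close>
      by (rule bexI exI refl)+ (intro span_add span_diff span_scale cl xy xy')+
  qed
qed

lemma card_double:
  assumes B: "frame B" and l: "\<And>b. b \<in> B \<Longrightarrow> form b l = 0" and ll: "form l l \<noteq> 0"
  shows "card (double B l) = 2 * card B + 1"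
proof -
  have fin: "finite B" and nz: "\<And>b. b \<in> B \<Longrightarrow> form b b \<noteq> 0" using B by (auto simp: frame_def)
  \<comment> \<open>Equal images would force \<open>form b b' = form b b\<close>, which is nonzero,
    so \<open>b\<close> and \<open>b'\<close> cannot be distinct orthogonal members.\<close>
  have "inj_on (\<lambda>b. b \<cdot> l) B"
  proof (rule inj_onI)
    fix b b' assume b: "b \<in> B" "b' \<in> B" and "b \<cdot> l = b' \<cdot> l"
    then have "form l l * form b b' = form l l * form b b"
      using form_double_cases(5)[OF B l] by metis
    then show "b = b'" using ll nz b B unfolding frame_def by fastforce
  qed
  then have "card ((\<lambda>b. b \<cdot> l) ` B) = card B" by (rule card_image)
  moreover have "B \<inter> (\<lambda>b. b \<cdot> l) ` B = {}"
    using form_double_cases(3)[OF B l] nz by fastforce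
  moreover have "l \<noteq> b \<cdot> l" for b
    using ll form_prod_right_self(1)[of b l] by metis
  then have "l \<notin> B \<union> (\<lambda>b. b \<cdot> l) ` B"
    using l ll by auto
  ultimately show ?thesis
    using fin by (simp add: double_def card_Un_disjoint)
qed


section \<open>Excluding a fourth doubling, and the possible dimensions\<close>

text \<open>
  The two ways of rebracketing \<open>((i \<cdot> j) \<cdot> l) \<cdot> m\<close> by sign-changing associativity differ in sign.
\<close>

lemma no_fourth_double:
  assumes ij: "form i j = 0" and l: "form i l = 0" "form j l = 0" "form (i \<cdot> j) l = 0"
    and m: "form i m = 0" "form j m = 0" "form (i \<cdot> j) m = 0" "form l m = 0"
      "form (i \<cdot> l) m = 0" "form (j \<cdot> l) m = 0" "form ((i \<cdot> j) \<cdot> l) m = 0"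
    and nz: "form i i \<noteq> 0" "form j j \<noteq> 0" "form l l \<noteq> 0" "form m m \<noteq> 0"
  shows False
proof -
  let ?p = "i \<cdot> (j \<cdot> (l \<cdot> m))"
  have jlm: "form j (l \<cdot> m) = 0" "form i (l \<cdot> m) = 0" "form i (j \<cdot> l) = 0"
    using m l form_prod_assoc by metis+
  have "((i \<cdot> j) \<cdot> l) \<cdot> m = - ((i \<cdot> j) \<cdot> (l \<cdot> m))"
    using prod_assoc_orthogonal l m by blast
  also have "(i \<cdot> j) \<cdot> (l \<cdot> m) = - ?p"
    using prod_assoc_orthogonal ij jlm by blast
  finally have 1: "((i \<cdot> j) \<cdot> l) \<cdot> m = ?p" by simp
  have "(i \<cdot> j) \<cdot> l = - (i \<cdot> (j \<cdot> l))"
    using prod_assoc_orthogonal ij l by blast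
  then have "((i \<cdot> j) \<cdot> l) \<cdot> m = - ((i \<cdot> (j \<cdot> l)) \<cdot> m)" by simp
  also have "(i \<cdot> (j \<cdot> l)) \<cdot> m = - (i \<cdot> ((j \<cdot> l) \<cdot> m))"
    using prod_assoc_orthogonal jlm m by blast
  also have "(j \<cdot> l) \<cdot> m = - (j \<cdot> (l \<cdot> m))"
    using prod_assoc_orthogonal l m by blast
  finally have "((i \<cdot> j) \<cdot> l) \<cdot> m = - ?p" by simp
  with 1 have "?p = 0" using eq_minus_self_imp_0 by metis
  \<comment> \<open>With this pairing zero, every cross term in the norm identity vanishes, so the
    norm of \<open>?p\<close> is the product of the four nonzero norms.\<close>
  moreover have "form i (j \<cdot> (l \<cdot> m)) = 0"
    using m(7) form_prod_assoc by metis
  then have "form ?p ?p = form i i * (form j j * (form l l * form m m))"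
    using jlm m by (simp add: form_prod_prod)
  ultimately show False using nz by simp
qed

text \<open>Doubling continues while the span is proper; the case names are the resulting
  dimensions.\<close>

lemma frame_chain_cases:
  obtains (0) "span {} = UNIV"
  | (1) i where "form i i \<noteq> 0" "span (double {} i) = UNIV"
  | (3) i j where "form i i \<noteq> 0" "\<And>b. b \<in> double {} i \<Longrightarrow> form b j = 0" "form j j \<noteq> 0"
      "span (double (double {} i) j) = UNIV"
  | (7) i j l where "form i i \<noteq> 0" "\<And>b. b \<in> double {} i \<Longrightarrow> form b j = 0" "form j j \<noteq> 0"
      "\<And>b. b \<in> double (double {} i) j \<Longrightarrow> form b l = 0" "form l l \<noteq> 0"
      "span (double (double (double {} i) j) l) = UNIV"
proof (cases "span {} = UNIV")
  case True
  then show ?thesis by (rule that)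
next
  case False
  then obtain i where i: "form i i \<noteq> 0"
    using exists_orthogonal_anisotropic[OF frame_empty] by blast
  then have f1: "frame (double {} i)" using frame_double[OF frame_empty] by simp
  show ?thesis
  proof (cases "span (double {} i) = UNIV")
    case True
    then show ?thesis using that i by blast
  next
    case False
    then obtain j where j: "\<And>b. b \<in> double {} i \<Longrightarrow> form b j = 0" "form j j \<noteq> 0"
      using exists_orthogonal_anisotropic[OF f1] by blast
    have f2: "frame (double (double {} i) j)" using f1 j by (rule frame_double)
    show ?thesis
    proof (cases "span (double (double {} i) j) = UNIV")
      case True
      then show ?thesis using that i j by blast
    next
      case False
      then obtain l where l: "\<And>b. b \<in> double (double {} i) j \<Longrightarrow> form b l = 0" "form l l \<noteq> 0"
        using exists_orthogonal_anisotropic[OF f2] by blast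
      have f3: "frame (double (double (double {} i) j) l)" using f2 l by (rule frame_double)
      have "span (double (double (double {} i) j) l) = UNIV"
      proof (rule ccontr)
        assume "span (double (double (double {} i) j) l) \<noteq> UNIV"
        then obtain m where
          "\<And>b. b \<in> double (double (double {} i) j) l \<Longrightarrow> form b m = 0" "form m m \<noteq> 0"
          using exists_orthogonal_anisotropic[OF f3] by blast
        \<comment> \<open>The triple double consists of \<open>i\<close>, \<open>j\<close>,
          \<open>i \<cdot> j\<close>, \<open>l\<close> and the products of the first three with
          \<open>l\<close>: exactly the seven vectors that \<open>m\<close> must be orthogonal
          to.\<close>
        then show False
          using no_fourth_double[of i j l m] i j l by (simp add: double_def)
      qed
      then show ?thesis using that i j l by blast
    qed
  qed
qed

lemma has_dimension_0_1_3_7: "\<exists>n\<in>{0, 1, 3, 7}. has_dimension n"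
proof -
  have frame_dim: "\<exists>n\<in>{0, 1, 3, 7}. has_dimension n"
    if "frame B" "card B = n" "n \<in> {0, 1, 3, 7}" "span B = UNIV" for B n
  proof -
    have "has_dimension n"
      unfolding has_dimension_def
      using that frame_independent[OF that(1)] by (intro exI[of _ B]) (simp add: frame_def)
    then show ?thesis using that(3) by blast
  qed
  have f1: "frame (double {} i)" "card (double {} i) = 1" if "form i i \<noteq> 0" for i
    using frame_double[OF frame_empty _ that] card_double[OF frame_empty _ that] by simp_all
  have f2: "frame (double (double {} i) j)" "card (double (double {} i) j) = 3"
    if i: "form i i \<noteq> 0" and j: "\<And>b. b \<in> double {} i \<Longrightarrow> form b j = 0" "form j j \<noteq> 0" for i j
  proof -
    show "frame (double (double {} i) j)" using f1(1)[OF i] j by (rule frame_double)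
    have "card (double (double {} i) j) = 2 * card (double {} i) + 1"
      using f1(1)[OF i] j by (rule card_double)
    then show "card (double (double {} i) j) = 3" using f1(2)[OF i] by simp
  qed
  show ?thesis
  proof (cases rule: frame_chain_cases)
    case 0
    then show ?thesis using frame_dim[OF frame_empty] by simp
  next
    case (1 i)
    show ?thesis using frame_dim[OF f1[OF 1(1)]] 1(2) by simp
  next
    case (3 i j)
    show ?thesis using frame_dim[OF f2[OF 3(1-3)]] 3(4) by simp
  next
    case (7 i j l)
    have "frame (double (double (double {} i) j) l)"
      using f2(1)[OF 7(1-3)] 7(4,5) by (rule frame_double)
    moreover have "card (double (double (double {} i) j) l) = 2 * card (double (double {} i) j) + 1"
      using f2(1)[OF 7(1-3)] 7(4,5) by (rule card_double)
    then have "card (double (double (double {} i) j) l) = 7"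
      using f2(2)[OF 7(1-3)] by simp
    ultimately show ?thesis using frame_dim 7(6) by blast
  qed
qed

text \<open>The reflection along \<open>x - y\<close> exchanges \<open>x\<close> and
  \<open>y\<close>, so it carries \<open>z\<close> into the complement of \<open>y\<close>, and it
  fixes every vector orthogonal to both. If \<open>x - y\<close> is isotropic, \<open>x + y\<close>
  is not, because their norms add up to four times that of \<open>x\<close>; reflecting along
  \<open>x + y\<close> sends \<open>x\<close> to \<open>- y\<close>, which serves equally
  well.\<close>

lemma exists_reflected:
  assumes xy: "form x x = form y y" "form x x \<noteq> 0" and z: "form z x = 0"
  obtains z' where "form z' z' = form z z" "form z' y = 0"
    "\<And>u. form u x = 0 \<Longrightarrow> form u y = 0 \<Longrightarrow> form u z = 0 \<Longrightarrow> form u z' = 0"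
proof -
  have reflect: "\<exists>z'. form z' z' = form z z \<and> form z' y = 0 \<and>
      (\<forall>u. form u x = 0 \<longrightarrow> form u y = 0 \<longrightarrow> form u z = 0 \<longrightarrow> form u z' = 0)"
    if xy: "form x x = form y y" and d: "form (x - y) (x - y) \<noteq> 0" for y
  proof -
    define d where "d = x - y"
    define z' where "z' = z - (2 * form z d / form d d) *s d"
    have dd: "form d d \<noteq> 0" using d by (simp add: d_def)
    have "form z' z' = form z z"
      using dd by (simp add: z'_def form_sym[of d z])
    moreover have "form z' y = 0"
    proof -
      \<comment> \<open>Equal norms of \<open>x\<close> and \<open>y\<close> give
        \<open>form d d = 2 * (form y y - form x y)\<close>.\<close>
      have zd: "form z d = - form z y" and dy: "2 * form d y = - form d d"
        using z xy by (simp_all add: d_def form_sym[of y x])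
      have "form z' y = form z y - form z d / form d d * (2 * form d y)"
        by (simp add: z'_def)
      then show ?thesis using dd by (simp only: zd dy) simp
    qed
    moreover have "form u z' = 0" if "form u x = 0" "form u y = 0" "form u z = 0" for u
      using that by (simp add: z'_def d_def)
    ultimately show ?thesis by blast
  qed
  have "form (x - y) (x - y) + form (x - - y) (x - - y) = 2 * (2 * form x x)"
    using xy(1) by simp
  then consider "form (x - y) (x - y) \<noteq> 0" | "form (x - - y) (x - - y) \<noteq> 0"
    using xy(2) two_neq_0 by (metis add.right_neutral mult_eq_0_iff)
  then show ?thesis
  proof cases
    case 1
    then show ?thesis using reflect[of y] xy(1) that by blast
  next
    case 2
    then obtain z' where "form z' z' = form z z" "form z' (- y) = 0"
      "\<And>u. form u x = 0 \<Longrightarrow> form u (- y) = 0 \<Longrightarrow> form u z = 0 \<Longrightarrow> form u z' = 0"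
      using reflect[of "- y"] xy(1) by auto
    then show ?thesis using that by simp
  qed
qed

end

section \<open>Extending isomorphisms through doublings\<close>

locale vector_product_algebra_pair =
  V: vector_product_algebra_char_neq_2 scaleV prodV formV +
  W: vector_product_algebra_char_neq_2 scaleW prodW formW
  for scaleV :: "'k::field \<Rightarrow> 'v::ab_group_add \<Rightarrow> 'v" and prodV formV
    and scaleW :: "'k \<Rightarrow> 'w::ab_group_add \<Rightarrow> 'w" and prodW formW
begin

text \<open>The map is linear on the whole space, but its behaviour outside the span is left free.
  This avoids partial maps while the domain grows.\<close>

definition preserves_on :: "'v set \<Rightarrow> ('v \<Rightarrow> 'w) \<Rightarrow> bool" where
  "preserves_on B \<phi> \<longleftrightarrow> Vector_Spaces.linear scaleV scaleW \<phi> \<and>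
    (\<forall>x\<in>V.span B. \<forall>y\<in>V.span B. \<phi> (prodV x y) = prodW (\<phi> x) (\<phi> y) \<and>
      formW (\<phi> x) (\<phi> y) = formV x y)"

text \<open>Sending \<open>l\<close> to \<open>l'\<close> prescribes the extension on normal forms.
  Both algebras obey the same Cayley-Dickson rules there, with the same constant
  \<open>formV l l\<close>, so product and form are preserved.\<close>

lemma extend_to_double:
  assumes \<phi>: "preserves_on B \<phi>" and B: "V.frame B"
    and l: "\<And>b. b \<in> B \<Longrightarrow> formV b l = 0" "formV l l \<noteq> 0"
    and l': "\<And>b. b \<in> B \<Longrightarrow> formW (\<phi> b) l' = 0" "formW l' l' = formV l l"
  obtains \<phi>' where "preserves_on (V.double B l) \<phi>'" "\<phi>' l = l'"
    "\<And>x. x \<in> V.span B \<Longrightarrow> \<phi>' x = \<phi> x" "\<And>x. x \<in> V.span B \<Longrightarrow> \<phi>' (prodV x l) = prodW (\<phi> x) l'"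
proof -
  interpret \<phi>: Vector_Spaces.linear scaleV scaleW \<phi>
    using \<phi> by (simp add: preserves_on_def)
  let ?c = "formV l l"
  \<comment> \<open>The three coordinates of \<open>x + s l + y \<cdot> l\<close> are recovered
    linearly: projection gives \<open>x\<close>, pairing with \<open>l\<close> gives
    \<open>s\<close>, and multiplying by \<open>l\<close> before projecting gives \<open>y\<close>
    times \<open>- ?c\<close>, hence the sign and the factor \<open>1 / ?c\<close>.\<close>
  define \<phi>' where "\<phi>' v = \<phi> (V.proj B v) + scaleW (formV v l / ?c) l'
    - scaleW (1 / ?c) (prodW (\<phi> (V.proj B (prodV v l))) l')" for v
  have lin: "Vector_Spaces.linear scaleV scaleW \<phi>'"
    unfolding Vector_Spaces.linear_iff
    by (simp add: \<phi>'_def V.vector_space_axioms W.vector_space_axioms V.proj_add V.proj_scale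
        \<phi>.add \<phi>.scale add_divide_distrib W.scale_left_distrib W.scale_right_distrib
        W.scale_right_diff_distrib algebra_simps)
  have perp_V: "formV x l = 0" if "x \<in> V.span B" for x
    using V.form_span_left_eq_0 that l(1) by blast
  have perp_W: "formW (\<phi> x) l' = 0" if "x \<in> V.span B" for x
    using that
    by (induction rule: V.span_induct_alt) (simp_all add: \<phi>.add \<phi>.scale l'(1))
  have cl: "prodV x y \<in> V.span B" if "x \<in> V.span B" "y \<in> V.span B" for x y
    using B that by (simp add: V.frame_def)
  have pr: "\<phi> (prodV x y) = prodW (\<phi> x) (\<phi> y)" "formW (\<phi> x) (\<phi> y) = formV x y"
    if "x \<in> V.span B" "y \<in> V.span B" for x y
    using \<phi> that by (simp_all add: preserves_on_def)
  have \<phi>'_eq: "\<phi>' (x + scaleV s l + prodV y l) = \<phi> x + scaleW s l' + prodW (\<phi> y) l'"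
    if xy: "x \<in> V.span B" "y \<in> V.span B" for x y s
  proof -
    have "V.proj B (prodV y l) = 0"
      using V.form_frame_span_prod(2)[OF B l(1) _ xy(2)] by (intro V.proj_orthogonal) (simp add: V.span_base)
    moreover have "V.proj B l = 0" using l(1) by (rule V.proj_orthogonal)
    moreover have "V.proj B (prodV x l) = 0"
      using V.form_frame_span_prod(2)[OF B l(1) _ xy(1)] by (intro V.proj_orthogonal) (simp add: V.span_base)
    ultimately show ?thesis
      using l(2) perp_V[OF xy(1)] perp_V[OF xy(2)]
      by (simp add: \<phi>'_def V.proj_add V.proj_diff V.proj_scale V.proj_span[OF B] xy
          V.prod_new_new \<phi>.neg \<phi>.scale)
  qed
  have "preserves_on (V.double B l) \<phi>'"
    unfolding preserves_on_def
  proof (intro conjI ballI lin)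
    fix u v assume uv: "u \<in> V.span (V.double B l)" "v \<in> V.span (V.double B l)"
    obtain x y s where u: "u = x + scaleV s l + prodV y l" and xy: "x \<in> V.span B" "y \<in> V.span B"
      using uv(1) V.span_double by blast
    obtain x' y' s' where v: "v = x' + scaleV s' l + prodV y' l"
      and xy': "x' \<in> V.span B" "y' \<in> V.span B"
      using uv(2) V.span_double by blast
    \<comment> \<open>Such a product is the image of a product in \<open>V.span B\<close>, so it is
      again orthogonal to \<open>l'\<close>.\<close>
    have perp_prod_W: "formW (prodW (\<phi> a) (\<phi> b)) l' = 0" if "a \<in> V.span B" "b \<in> V.span B" for a b
      using perp_W[OF cl[OF that]] pr(1)[OF that] by simp
    note images = \<phi>'_eq[OF xy] \<phi>'_eq[OF xy']
    have "\<phi>' (prodV u v) =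
      \<phi> (prodV x x' + scaleV (?c * s) y' - scaleV (?c * s') y - scaleV ?c (prodV y y'))
      + scaleW (formV x' y - formV x y') l'
      + prodW (\<phi> (scaleV s' x - scaleV s x' - prodV x y' + prodV x' y)) l'"
      unfolding u v using xy xy'
      by (subst V.cayley_dickson_prod;
          intro \<phi>'_eq V.span_add V.span_diff V.span_scale perp_V cl xy xy')
    also have "\<dots> = prodW (\<phi>' u) (\<phi>' v)"
      unfolding u v images
      by (subst W.cayley_dickson_prod)
        (simp_all add: perp_W perp_prod_W xy xy' pr l'(2) \<phi>.add \<phi>.diff \<phi>.scale)
    finally show "\<phi>' (prodV u v) = prodW (\<phi>' u) (\<phi>' v)" .
    have "formV u v = formV x x' + ?c * (s * s' + formV y y')"
      unfolding u v by (intro V.cayley_dickson_form perp_V cl xy xy')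
    moreover have "formW (\<phi>' u) (\<phi>' v) =
        formW (\<phi> x) (\<phi> x') + formW l' l' * (s * s' + formW (\<phi> y) (\<phi> y'))"
      unfolding u v images by (intro W.cayley_dickson_form perp_W perp_prod_W xy xy')
    ultimately show "formW (\<phi>' u) (\<phi>' v) = formV u v"
      by (simp only: pr xy xy' l'(2))
  qed
  moreover have "\<phi>' l = l'" "\<And>x. x \<in> V.span B \<Longrightarrow> \<phi>' x = \<phi> x"
    "\<And>x. x \<in> V.span B \<Longrightarrow> \<phi>' (prodV x l) = prodW (\<phi> x) l'"
    using \<phi>'_eq[of 0 0 1] \<phi>'_eq[of _ 0 0] \<phi>'_eq[of 0 _ 0] by (simp_all add: V.span_zero)
  ultimately show ?thesis using that by blast
qed

text \<open>Preserving a non-degenerate form makes \<open>\<phi>\<close> injective. The bijection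
  \<open>\<psi>\<close> serves only to get surjectivity: \<open>inv \<psi> \<circ> \<phi>\<close> is
  an injective endomorphism of a finite-dimensional space.\<close>

lemma isomorphic_if_preserves:
  assumes \<phi>: "preserves_on B \<phi>" and B: "V.frame B" "V.span B = UNIV"
    and \<psi>: "orthogonal_map scaleV formV scaleW formW \<psi>" "bij \<psi>"
  shows "vpa_isomorphic scaleV prodV formV scaleW prodW formW"
proof -
  interpret \<psi>: orthogonal_map scaleV formV scaleW formW \<psi> by (rule \<psi>(1))
  interpret \<phi>: Vector_Spaces.linear scaleV scaleW \<phi>
    using \<phi> by (simp add: preserves_on_def)
  interpret fd: finite_dimensional_vector_space scaleV B
    using B V.frame_independent[OF B(1)] by unfold_locales (auto simp: V.frame_def)
  have pr: "\<phi> (prodV x y) = prodW (\<phi> x) (\<phi> y)" "formW (\<phi> x) (\<phi> y) = formV x y" for x y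
    using \<phi> B(2) by (simp_all add: preserves_on_def)
  have "x = 0" if "\<phi> x = 0" for x
    using V.form_nondegenerate pr(2)[of _ x] that by simp
  then have "inj \<phi>" using \<phi>.inj_iff_eq_0 by blast
  have lin: "Vector_Spaces.linear scaleV scaleV (inv \<psi> \<circ> \<phi>)"
  proof -
    have eq: "inv \<psi> (\<psi> x) = x" "\<psi> (inv \<psi> w) = w" for x w
      using \<psi>(2) by (simp_all add: bij_is_inj bij_is_surj surj_f_inv_f)
    have "inv \<psi> (w + w') = inv \<psi> w + inv \<psi> w'" "inv \<psi> (scaleW c w) = scaleV c (inv \<psi> w)" for w w' c
      using eq \<psi>.add \<psi>.scale by metis+
    then show ?thesis
      unfolding Vector_Spaces.linear_iff by (simp add: V.vector_space_axioms \<phi>.add \<phi>.scale)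
  qed
  have "inj (inv \<psi>)" using \<psi>(2) by (simp add: bij_imp_bij_inv bij_is_inj)
  then have "surj (inv \<psi> \<circ> \<phi>)"
    using fd.linear_inj_imp_surj[OF lin] \<open>inj \<phi>\<close> by (simp add: inj_compose)
  then have "surj (\<psi> \<circ> (inv \<psi> \<circ> \<phi>))"
    using bij_is_surj[OF \<psi>(2)] by (rule comp_surj)
  moreover have "\<psi> \<circ> (inv \<psi> \<circ> \<phi>) = \<phi>"
    using \<psi>(2) by (auto simp: bij_is_surj surj_f_inv_f)
  ultimately have "bij \<phi>" using \<open>inj \<phi>\<close> by (simp add: bij_def)
  moreover have "vpa_morphism scaleV prodV formV scaleW prodW formW \<phi>"
    by unfold_locales (simp_all add: pr)
  ultimately show ?thesis unfolding vpa_isomorphic_def by blast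
qed

lemma isomorphic_if_forms_equivalent:
  assumes "forms_equivalent scaleV formV scaleW formW"
  shows "vpa_isomorphic scaleV prodV formV scaleW prodW formW"
proof -
  obtain \<psi> where \<psi>: "orthogonal_map scaleV formV scaleW formW \<psi>" "bij \<psi>"
    using assms unfolding forms_equivalent_def by blast
  interpret \<psi>: orthogonal_map scaleV formV scaleW formW \<psi> by (rule \<psi>(1))
  note iso = isomorphic_if_preserves[OF _ _ _ \<psi>]
  \<comment> \<open>The chain starts at the empty frame, whose span contains only 0.\<close>
  have zero: "preserves_on {} (\<lambda>_. 0)"
    by (simp add: preserves_on_def Vector_Spaces.linear_iff V.vector_space_axioms W.vector_space_axioms)
  have double1: "\<exists>\<phi>. preserves_on (V.double {} i) \<phi> \<and> \<phi> i = \<psi> i" if "formV i i \<noteq> 0" for i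
    by (rule extend_to_double[OF zero V.frame_empty _ that, of "\<psi> i"])
      (auto simp: \<psi>.form_preserving)
  \<comment> \<open>The value at \<open>prodV i j\<close> is recorded because the image of the third
    generator must be orthogonal to this vector rather than to
    \<open>\<psi> (prodV i j)\<close>.\<close>
  have double2: "\<exists>\<phi>. preserves_on (V.double (V.double {} i) j) \<phi> \<and> \<phi> i = \<psi> i \<and> \<phi> j = \<psi> j \<and>
      \<phi> (prodV i j) = prodW (\<psi> i) (\<psi> j)"
    if i: "formV i i \<noteq> 0" and j: "\<And>b. b \<in> V.double {} i \<Longrightarrow> formV b j = 0" "formV j j \<noteq> 0" for i j
  proof -
    obtain \<phi> where \<phi>: "preserves_on (V.double {} i) \<phi>" "\<phi> i = \<psi> i" using double1[OF i] by blast
    have frame: "V.frame (V.double {} i)" using i V.frame_double[OF V.frame_empty] by simp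
    have i_in: "i \<in> V.span (V.double {} i)" by (rule V.span_base[OF V.subset_double(2)])
    have "formW (\<phi> b) (\<psi> j) = 0" if "b \<in> V.double {} i" for b
      using that j(1)[OF that] \<phi>(2) by (auto simp: V.double_def \<psi>.form_preserving)
    then obtain \<phi>' where "preserves_on (V.double (V.double {} i) j) \<phi>'" "\<phi>' j = \<psi> j"
      "\<phi>' i = \<phi> i" "\<phi>' (prodV i j) = prodW (\<phi> i) (\<psi> j)"
      using extend_to_double[OF \<phi>(1) frame j, of "\<psi> j"] i_in \<psi>.form_preserving by metis
    then show ?thesis using \<phi>(2) by auto
  qed
  show ?thesis
  proof (cases rule: V.frame_chain_cases)
    case 0
    then show ?thesis using iso[OF zero V.frame_empty] by blast
  next
    case (1 i)
    then show ?thesis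
      using iso double1 V.frame_double[OF V.frame_empty] by (metis empty_iff)
  next
    case (3 i j)
    have "V.frame (V.double {} i)" using 3 V.frame_double[OF V.frame_empty] by simp
    then have "V.frame (V.double (V.double {} i) j)" using 3 V.frame_double by blast
    then show ?thesis using iso double2 3 by blast
  next
    case (7 i j l)
    have "V.frame (V.double {} i)" using 7 V.frame_double[OF V.frame_empty] by simp
    then have f2: "V.frame (V.double (V.double {} i) j)" using 7 V.frame_double by blast
    then have f3: "V.frame (V.double (V.double (V.double {} i) j) l)" using 7 V.frame_double by blast
    obtain \<phi> where \<phi>: "preserves_on (V.double (V.double {} i) j) \<phi>" "\<phi> i = \<psi> i" "\<phi> j = \<psi> j"
      "\<phi> (prodV i j) = prodW (\<psi> i) (\<psi> j)"
      using double2 7 by blast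
    have ij: "formV i j = 0" and il: "formV i l = 0" "formV j l = 0" "formV (prodV i j) l = 0"
      using 7 by (simp_all add: V.double_def)
    text \<open>
      \<open>\<psi> l\<close> need not be orthogonal to \<open>\<psi> i \<cdot> \<psi> j\<close>, only to \<open>\<psi> (i \<cdot> j)\<close>; as these two vectors have the
      same norm, a reflection repairs this without moving \<open>\<psi> i\<close> and \<open>\<psi> j\<close>.
    \<close>
    have norms: "formW (\<psi> (prodV i j)) (\<psi> (prodV i j)) =
        formW (prodW (\<psi> i) (\<psi> j)) (prodW (\<psi> i) (\<psi> j))"
      "formW (\<psi> (prodV i j)) (\<psi> (prodV i j)) \<noteq> 0"
      using 7(1,3) ij by (simp_all add: \<psi>.form_preserving V.form_prod_prod W.form_prod_prod)
    have "formW (\<psi> l) (\<psi> (prodV i j)) = 0"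
      using il(3) by (simp add: \<psi>.form_preserving V.form_sym[of l])
    then obtain l' where l': "formW l' l' = formW (\<psi> l) (\<psi> l)" "formW l' (prodW (\<psi> i) (\<psi> j)) = 0"
      "\<And>u. formW u (\<psi> (prodV i j)) = 0 \<Longrightarrow> formW u (prodW (\<psi> i) (\<psi> j)) = 0 \<Longrightarrow>
        formW u (\<psi> l) = 0 \<Longrightarrow> formW u l' = 0"
      using W.exists_reflected[OF norms] by metis
    have "formW (\<psi> i) l' = 0" "formW (\<psi> j) l' = 0"
      using il by (auto intro!: l'(3) simp: \<psi>.form_preserving)
    moreover have "formW (prodW (\<psi> i) (\<psi> j)) l' = 0"
      using l'(2) W.form_sym by metis
    ultimately have "formW (\<phi> b) l' = 0" if "b \<in> V.double (V.double {} i) j" for b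
      using that \<phi>(2-4) by (auto simp: V.double_def)
    then obtain \<phi>' where "preserves_on (V.double (V.double (V.double {} i) j) l) \<phi>'"
      using extend_to_double[OF \<phi>(1) f2 7(4,5), of l'] l'(1) \<psi>.form_preserving by metis
    then show ?thesis using iso f3 7(6) by blast
  qed
qed

end

theorem theorem1:
  fixes scaleV :: "'k::field \<Rightarrow> 'v::ab_group_add \<Rightarrow> 'v"
    and prodV :: "'v \<Rightarrow> 'v \<Rightarrow> 'v" and formV :: "'v \<Rightarrow> 'v \<Rightarrow> 'k"
    and scaleW :: "'k \<Rightarrow> 'w::ab_group_add \<Rightarrow> 'w"
    and prodW :: "'w \<Rightarrow> 'w \<Rightarrow> 'w" and formW :: "'w \<Rightarrow> 'w \<Rightarrow> 'k"
  assumes char_neq_2: "CHAR('k) \<noteq> 2"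
  shows "(vector_product_algebra scaleV prodV formV \<longrightarrow>
            (\<exists>n\<in>{0, 1, 3, 7}. vector_space.has_dimension scaleV n)) \<and>
         (vector_product_algebra scaleV prodV formV \<longrightarrow>
          vector_product_algebra scaleW prodW formW \<longrightarrow>
            (vpa_isomorphic scaleV prodV formV scaleW prodW formW \<longleftrightarrow>
             forms_equivalent scaleV formV scaleW formW))"
proof -
  have two: "(2::'k) \<noteq> 0" using char_neq_2 by (rule two_neq_0_if_CHAR_neq_2)
  note loc = vector_product_algebra_char_neq_2.intro
    [OF _ vector_product_algebra_char_neq_2_axioms.intro[OF two]]
  show ?thesis
  proof (intro conjI impI)
    assume "vector_product_algebra scaleV prodV formV"
    from loc[OF this] show "\<exists>n\<in>{0, 1, 3, 7}. vector_space.has_dimension scaleV n"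
      by (rule vector_product_algebra_char_neq_2.has_dimension_0_1_3_7)
  next
    assume V: "vector_product_algebra scaleV prodV formV"
      and W: "vector_product_algebra scaleW prodW formW"
    show "vpa_isomorphic scaleV prodV formV scaleW prodW formW \<longleftrightarrow>
        forms_equivalent scaleV formV scaleW formW"
    proof
      assume "vpa_isomorphic scaleV prodV formV scaleW prodW formW"
      then show "forms_equivalent scaleV formV scaleW formW"
        unfolding vpa_isomorphic_def forms_equivalent_def vpa_morphism_def by blast
    next
      assume "forms_equivalent scaleV formV scaleW formW"
      then show "vpa_isomorphic scaleV prodV formV scaleW prodW formW"
        by (rule vector_product_algebra_pair.isomorphic_if_forms_equivalent
            [OF vector_product_algebra_pair.intro[OF loc[OF V] loc[OF W]]])
    qed
  qed
qed

end
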